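(* Let $q, r \in (0,\infty)$ and let $\Omega_{(q,r)} : \mathbb{R} \to [0,\infty)$ be the (continuous) probability density function of $q X_1 + r X_2$, where $X_1$ and $X_2$ are independent standard exponential random variables (mean $1$). Fix an integer $p \geq 2$ and a real number $\alpha \geq 0$. (1) If $\alpha \in \mathbb{Z}_{\geq 0} \cup (p-2, \infty)$, then the function $\Omega_{(q,r)}^\alpha : \mathbb{R} \to \mathbb{R}$, $x \mapsto \Omega_{(q,r)}(x)^\alpha$, is $\mathrm{TN}_p$. (2) If $\alpha \in (0, p-2) \setminus \mathbb{Z}$, then $\Omega_{(q,r)}^\alpha$ is not $\mathrm{TN}_p$. More strongly, given arbitrary real numbers $x_1 < \cdots < x_p$ and $y_1 < \cdots < y_p$, there exists $a \in \mathbb{R}$ such that the $p \times p$ matrix \[ \bigl( \Omega_{(q,r)}(x_j - y_k - a)^\alpha \bigr)_{j,k=1}^p \] is $\mathrm{TP}$ if $\alpha > p-2$, is $\mathrm{TN}$ if $\alpha \in \{0, 1, \ldots, p-2\}$, and has a negative principal minor if $\alpha \in (0, p-2) \setminus \mathbb{Z}$.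
   Context: $\mathbb{Z}_{\geq 0} = \{0,1,2,\ldots\}$. Explicitly, $\Omega_{(q,r)}(x) = 0$ for $x < 0$, and for $x \geq 0$ it equals $\frac{e^{-x/q} - e^{-x/r}}{q - r}$ if $q \neq r$ and $q^{-2} x e^{-x/q}$ if $q = r$. A function $\Lambda : \mathbb{R} \to \mathbb{R}$ is $\mathrm{TN}_p$ (totally non-negative of order $p$) if for every $1 \leq n \leq p$ and all reals $x_1 < \cdots < x_n$, $y_1 < \cdots < y_n$ one has $\det(\Lambda(x_i - y_j))_{i,j=1}^n \geq 0$. A real matrix is $\mathrm{TP}$ (respectively $\mathrm{TN}$) if all of its minors (determinants of square submatrices with rows and columns in increasing order) are positive (respectively non-negative). *)

theory Defs
  imports
    "HOL-Probability.Probability"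
    "Jordan_Normal_Form.Determinant"
    "Jordan_Normal_Form.DL_Submatrix"
begin

text \<open>
  Real powers of non-negative reals with the convention \<open>0 ^ 0 = 1\<close>; the library has
  \<open>0 powr 0 = 0\<close>. For \<open>a > 0\<close> this is \<open>t powr a\<close>, in particular \<open>0\<close> at \<open>t = 0\<close>.
\<close>
definition rpow :: "real \<Rightarrow> real \<Rightarrow> real" where
  "rpow t a = (if a = 0 then 1 else t powr a)"

definition TN_kernel :: "nat \<Rightarrow> (real \<Rightarrow> real) \<Rightarrow> bool" where
  "TN_kernel p L \<longleftrightarrow>
     (\<forall>n x y. 1 \<le> n \<and> n \<le> p \<and>
        strict_mono_on {..<n} (x :: nat \<Rightarrow> real) \<and> strict_mono_on {..<n} (y :: nat \<Rightarrow> real) \<longrightarrow>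
        Determinant.det (Matrix.mat n n (\<lambda>(i, j). L (x i - y j))) \<ge> 0)"

text \<open>
  Rows and columns of matrices are indexed from \<open>0\<close>, and \<open>submatrix A I J\<close> lists the rows in
  \<open>I\<close> and the columns in \<open>J\<close> in increasing order.
\<close>
definition minor_index :: "'a mat \<Rightarrow> nat set \<Rightarrow> nat set \<Rightarrow> bool" where
  "minor_index A I J \<longleftrightarrow>
     I \<subseteq> {..<dim_row A} \<and> J \<subseteq> {..<dim_col A} \<and> card I = card J \<and> I \<noteq> {} \<and> J \<noteq> {}"

definition TP_mat :: "real mat \<Rightarrow> bool" where
  "TP_mat A \<longleftrightarrow> (\<forall>I J. minor_index A I J \<longrightarrow> Determinant.det (submatrix A I J) > 0)"

definition TN_mat :: "real mat \<Rightarrow> bool" where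
  "TN_mat A \<longleftrightarrow> (\<forall>I J. minor_index A I J \<longrightarrow> Determinant.det (submatrix A I J) \<ge> 0)"

definition has_neg_principal_minor :: "real mat \<Rightarrow> bool" where
  "has_neg_principal_minor A \<longleftrightarrow>
     (\<exists>I. minor_index A I I \<and> Determinant.det (submatrix A I I) < 0)"

end

theory Submission
  imports Defs
begin

text \<open>
  The density satisfies \<open>\<Omega> (x - y) = a x * b y * max 0 (E x - E y)\<close> with \<open>a, b > 0\<close> and \<open>E\<close> strictly
  increasing, so everything reduces to the truncated power kernel \<open>max 0 (x - y) powr \<alpha>\<close>.
  Dividing the rows of its determinant of order \<open>n\<close> by the entries of the first column and
  substituting \<open>t = - 1 / (x - y\<^sub>0)\<close> turns the first column into ones and the other columns into
  multiples of \<open>max 0 (t - Y) powr \<alpha>\<close>. Subtracting consecutive rows, and applying the mean value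
  theorem row by row, replaces the determinant up to a positive factor by \<open>\<alpha> ^ (n - 1)\<close> times one of
  order \<open>n - 1\<close> and exponent \<open>\<alpha> - 1\<close>. Hence the sign for \<open>y\<^sub>j < x\<^sub>i\<close> is that of
  \<open>\<Prod>k<n-1. (\<alpha> - k) ^ (n - 1 - k)\<close>, which is negative for \<open>n - 3 < \<alpha> < n - 2\<close>.
\<close>

subsection \<open>Determinants of differences\<close>

lemma det_mat_scale:
  fixes f :: "nat \<Rightarrow> nat \<Rightarrow> real"
  shows "Determinant.det (Matrix.mat n n (\<lambda>(i, j). a i * b j * f i j)) =
    (\<Prod>i<n. a i) * (\<Prod>j<n. b j) * Determinant.det (Matrix.mat n n (\<lambda>(i, j). f i j))"
proof -
  have "(\<Prod>i = 0..<n. Matrix.mat n n (\<lambda>(i, j). a i * b j * f i j) $$ (i, p i)) =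
      (\<Prod>i<n. a i) * (\<Prod>j<n. b j) * (\<Prod>i = 0..<n. Matrix.mat n n (\<lambda>(i, j). f i j) $$ (i, p i))"
    if p: "p permutes {0..<n}" for p
  proof -
    have *: "p i < n" if "i < n" for i
      using permutes_in_image[OF p, of i] that by simp
    have "(\<Prod>j<n. b j) = (\<Prod>i=0..<n. b (p i))"
      using prod.permute[OF p, of b] by (simp add: o_def atLeast0LessThan)
    then show ?thesis
      using * by (simp add: prod.distrib atLeast0LessThan)
  qed
  then have "(\<Sum>p | p permutes {0..<n}. signof p *
        (\<Prod>i = 0..<n. Matrix.mat n n (\<lambda>(i, j). a i * b j * f i j) $$ (i, p i))) =
      (\<Sum>p | p permutes {0..<n}. (\<Prod>i<n. a i) * (\<Prod>j<n. b j) *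
        (signof p * (\<Prod>i = 0..<n. Matrix.mat n n (\<lambda>(i, j). f i j) $$ (i, p i))))"
    by (intro sum.cong) simp_all
  then show ?thesis
    by (simp add: det_def'[of _ n] sum_distrib_left)
qed

text \<open>The coefficients are the cofactors along row \<open>k\<close>; deleting that row makes
  them independent of \<open>v\<close>. Hiding them behind \<open>c\<close> lets the same linear
  form be applied to values and to derivatives.\<close>

lemma det_mat_row_linear:
  fixes F :: "nat \<Rightarrow> nat \<Rightarrow> real"
  assumes "k < n"
  obtains c where "\<And>v. Determinant.det (Matrix.mat n n (\<lambda>(i, j). if i = k then v j else F i j)) =
    (\<Sum>j<n. v j * c j)"
proof
  fix v :: "nat \<Rightarrow> real"
  let ?A = "\<lambda>v. Matrix.mat n n (\<lambda>(i, j). if i = k then v j else F i j)"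
  have "mat_delete (?A v) k j = mat_delete (?A (\<lambda>_. 0)) k j" for j
    by (auto simp: mat_delete_def intro!: eq_matI)
  then have "cofactor (?A v) k j = cofactor (?A (\<lambda>_. 0)) k j" for j
    by (simp add: cofactor_def)
  then show "Determinant.det (?A v) = (\<Sum>j<n. v j * cofactor (?A (\<lambda>_. 0)) k j)"
    using assms by (subst laplace_expansion_row[of _ n k]) auto
qed

text \<open>Subtracting from each row its predecessor is left multiplication by the unit lower
  bidiagonal matrix \<open>L\<close>, of determinant 1. The first column becomes the first unit
  vector, and expanding along it leaves the differences.\<close>

lemma det_ones_first_column:
  fixes f :: "nat \<Rightarrow> nat \<Rightarrow> real"
  shows "Determinant.det (Matrix.mat (Suc m) (Suc m) (\<lambda>(i, j). if j = 0 then 1 else f i (j - 1))) =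
    Determinant.det (Matrix.mat m m (\<lambda>(i, j). f (Suc i) j - f i j))"
proof -
  let ?n = "Suc m"
  define A where "A = Matrix.mat ?n ?n (\<lambda>(i, j). if j = 0 then 1 else f i (j - 1))"
  define L :: "real mat" where
    "L = Matrix.mat ?n ?n (\<lambda>(i, j). if i = j then 1 else if i = Suc j then -1 else 0)"
  have A: "A \<in> carrier_mat ?n ?n" and L: "L \<in> carrier_mat ?n ?n"
    by (auto simp: A_def L_def)
  have "Determinant.det L = prod_list (diag_mat L)"
    by (rule det_lower_triangular[OF _ L]) (auto simp: L_def)
  also have "\<dots> = 1"
    by (simp add: prod_list_diag_prod L_def)
  finally have detL: "Determinant.det L = 1" .
  have LA: "(L * A) $$ (i, j) = (if i = 0 then A $$ (0, j) else A $$ (i, j) - A $$ (i - 1, j))"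
    if ij: "i < ?n" "j < ?n" for i j
  proof -
    have "(L * A) $$ (i, j) = (\<Sum>k = 0..<?n. L $$ (i, k) * A $$ (k, j))"
      using ij A L by (simp add: scalar_prod_def)
    \<comment> \<open>Row \<open>i\<close> of \<open>L\<close> has 1 at position \<open>i\<close>
      and -1 at \<open>i - 1\<close>. The guard \<open>i \<noteq> 0\<close> excludes the truncated
      value \<open>0 - 1 = 0\<close>.\<close>
    also have "\<dots> = (\<Sum>k = 0..<?n. (if k = i then A $$ (i, j) else 0) +
        (if k = i - 1 \<and> i \<noteq> 0 then - A $$ (i - 1, j) else 0))"
      using ij by (intro sum.cong) (auto simp: L_def)
    also have "\<dots> = (if i = 0 then A $$ (0, j) else A $$ (i, j) - A $$ (i - 1, j))"
      using ij by (cases "i = 0") (auto simp: sum.distrib sum.delta)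
    finally show ?thesis .
  qed
  have LAc: "L * A \<in> carrier_mat ?n ?n" using A L by simp
  have "Determinant.det A = Determinant.det (L * A)"
    using det_mult[OF L A] detL by simp
  also have "\<dots> = (\<Sum>i<?n. (L * A) $$ (i, 0) * cofactor (L * A) i 0)"
    by (rule laplace_expansion_column[OF LAc]) simp
  also have "\<dots> = (\<Sum>i<?n. if i = 0 then cofactor (L * A) 0 0 else 0)"
    by (intro sum.cong refl, subst LA) (auto simp: A_def)
  also have "\<dots> = cofactor (L * A) 0 0"
    by (simp add: sum.delta)
  also have "mat_delete (L * A) 0 0 = Matrix.mat m m (\<lambda>(i, j). f (Suc i) j - f i j)"
  proof (rule eq_matI)
    fix i j assume ij: "i < dim_row (Matrix.mat m m (\<lambda>(i, j). f (Suc i) j - f i j))"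
      "j < dim_col (Matrix.mat m m (\<lambda>(i, j). f (Suc i) j - f i j))"
    have "mat_delete (L * A) 0 0 $$ (i, j) = (L * A) $$ (Suc i, Suc j)"
      using ij A L by (simp add: mat_delete_def)
    also have "\<dots> = f (Suc i) j - f i j"
      using ij by (subst LA) (auto simp: A_def)
    finally show "mat_delete (L * A) 0 0 $$ (i, j) =
        Matrix.mat m m (\<lambda>(i, j). f (Suc i) j - f i j) $$ (i, j)" using ij by simp
  qed (use A L in \<open>auto simp: mat_delete_def\<close>)
  then have "cofactor (L * A) 0 0 = Determinant.det (Matrix.mat m m (\<lambda>(i, j). f (Suc i) j - f i j))"
    by (simp add: cofactor_def)
  finally show ?thesis by (simp add: A_def)
qed

text \<open>
  \<open>P\<close> is a sign condition that passes from the derivative of a function to its increments. As the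
  determinant is linear in each row, the differences can be replaced by derivatives one row at a time.
\<close>
lemma det_differences_cone:
  fixes G G' :: "nat \<Rightarrow> real \<Rightarrow> real" and P :: "real \<Rightarrow> bool"
  assumes cone: "\<And>h h' a b. a < b \<Longrightarrow> continuous_on {a..b} h \<Longrightarrow>
      (\<And>x. x \<in> {a<..<b} - S \<Longrightarrow> (h has_real_derivative h' x) (at x)) \<Longrightarrow>
      (\<And>x. x \<in> {a<..<b} - S \<Longrightarrow> P (h' x)) \<Longrightarrow> P (h b - h a)"
    and ab: "\<And>i. i < m \<Longrightarrow> a i < b i"
    and cont: "\<And>i j. i < m \<Longrightarrow> j < m \<Longrightarrow> continuous_on {a i..b i} (G j)"
    and deriv: "\<And>i j x. i < m \<Longrightarrow> j < m \<Longrightarrow> x \<in> {a i<..<b i} - S \<Longrightarrow>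
      (G j has_real_derivative G' j x) (at x)"
    and P: "\<And>\<tau>. (\<And>i. i < m \<Longrightarrow> \<tau> i \<in> {a i<..<b i} - S) \<Longrightarrow>
      P (Determinant.det (Matrix.mat m m (\<lambda>(i, j). G' j (\<tau> i))))"
  shows "P (Determinant.det (Matrix.mat m m (\<lambda>(i, j). G j (b i) - G j (a i))))"
proof -
  let ?D = "\<lambda>k \<tau>. Determinant.det (Matrix.mat m m
    (\<lambda>(i, j). if i < k then G' j (\<tau> i) else G j (b i) - G j (a i)))"
  \<comment> \<open>In \<open>?D k \<tau>\<close> the first \<open>k\<close> rows hold derivatives
    and the others hold increments. The induction descends from \<open>k = m\<close>, which is the
    assumption \<open>P\<close>, to \<open>k = 0\<close>, which is the goal.\<close>
  have "P (?D k \<tau>)" if "k \<le> m" "\<And>i. i < k \<Longrightarrow> \<tau> i \<in> {a i<..<b i} - S" for k \<tau>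
    using that
  proof (induction k arbitrary: \<tau> rule: inc_induct)
    case base
    have "Matrix.mat m m (\<lambda>(i, j). if i < m then G' j (\<tau> i) else G j (b i) - G j (a i)) =
      Matrix.mat m m (\<lambda>(i, j). G' j (\<tau> i))"
      by (auto intro!: eq_matI)
    with P[of \<tau>] base show ?case by simp
  next
    case (step k)
    define F where "F = (\<lambda>i j. if i < k then G' j (\<tau> i) else G j (b i) - G j (a i))"
    obtain c where c: "\<And>v. Determinant.det (Matrix.mat m m (\<lambda>(i, j). if i = k then v j else F i j)) =
      (\<Sum>j<m. v j * c j)"
      using det_mat_row_linear[OF \<open>k < m\<close>] by blast
    define h where "h = (\<lambda>x. \<Sum>j<m. G j x * c j)"
    define h' where "h' = (\<lambda>x. \<Sum>j<m. G' j x * c j)"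
    have "P (h (b k) - h (a k))"
    proof (rule cone[of "a k" "b k" h h'])
      show "a k < b k" using ab step by simp
      show "continuous_on {a k..b k} h"
        unfolding h_def using step by (intro continuous_intros cont) auto
      show "(h has_real_derivative h' x) (at x)" if "x \<in> {a k<..<b k} - S" for x
        unfolding h_def h'_def using step that
        by (intro DERIV_sum DERIV_cmult_right deriv) auto
      show "P (h' x)" if x: "x \<in> {a k<..<b k} - S" for x
      proof -
        \<comment> \<open>The induction hypothesis holds for all sample points, so the
          \<open>k\<close>-th one may vary while the earlier ones stay fixed. This gives the sign of
          \<open>h'\<close> on the whole interval apart from \<open>S\<close>.\<close>
        have "P (?D (Suc k) (\<tau>(k := x)))"
          using step x by (intro step.IH) (auto simp: less_Suc_eq)
        moreover have "Matrix.mat m m (\<lambda>(i, j). if i < Suc k then G' j ((\<tau>(k := x)) i)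
            else G j (b i) - G j (a i)) =
          Matrix.mat m m (\<lambda>(i, j). if i = k then G' j x else F i j)"
          by (auto intro!: eq_matI simp: F_def)
        ultimately show ?thesis
          using c[of "\<lambda>j. G' j x"] by (simp add: h'_def)
      qed
    qed
    moreover have "Matrix.mat m m (\<lambda>(i, j). if i < k then G' j (\<tau> i) else G j (b i) - G j (a i)) =
      Matrix.mat m m (\<lambda>(i, j). if i = k then G j (b k) - G j (a k) else F i j)"
      by (auto intro!: eq_matI simp: F_def)
    ultimately show ?case
      using c[of "\<lambda>j. G j (b k) - G j (a k)"]
      by (simp add: h_def sum_subtractf left_diff_distrib)
  qed
  from this[of 0] show ?thesis by simp
qed

text \<open>The increment is the integral of the derivative, and setting the integrand to 0 at the
  finitely many exceptional points does not affect this. Strict signs are lost, but knots inside the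
  interval are allowed.\<close>

lemma increment_nonneg_off_finite:
  fixes h :: "real \<Rightarrow> real"
  assumes "finite S" "a < b" "continuous_on {a..b} h"
    and "\<And>x. x \<in> {a<..<b} - S \<Longrightarrow> (h has_real_derivative h' x) (at x)"
    and "\<And>x. x \<in> {a<..<b} - S \<Longrightarrow> h' x \<ge> 0"
  shows "h b - h a \<ge> 0"
proof -
  define g where "g = (\<lambda>x. if x \<in> {a<..<b} - S then h' x else 0)"
  have "(g has_integral (h b - h a)) {a..b}"
    using assms by (intro fundamental_theorem_of_calculus_interior_strong[of S])
      (auto simp: g_def has_real_derivative_iff_has_vector_derivative)
  then show ?thesis
    by (rule has_integral_nonneg) (use assms in \<open>auto simp: g_def\<close>)
qed

text \<open>By the mean value theorem the increment is a positive multiple of one value of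
  \<open>h'\<close>. The sign \<open>s\<close> may be 0, which occurs for small integer
  exponents.\<close>

lemma increment_sgn:
  fixes h :: "real \<Rightarrow> real"
  assumes "a < b" "continuous_on {a..b} h"
    and "\<And>x. x \<in> {a<..<b} \<Longrightarrow> (h has_real_derivative h' x) (at x)"
    and "\<And>x. x \<in> {a<..<b} \<Longrightarrow> sgn (h' x) = s"
  shows "sgn (h b - h a) = s"
proof -
  have "h differentiable at x" if "a < x" "x < b" for x
    using assms(3)[of x] that unfolding real_differentiable_def by auto
  from MVT[OF assms(1,2) this]
  obtain l z where z: "a < z" "z < b" "DERIV h z :> l" "h b - h a = (b - a) * l"
    by auto
  then have "l = h' z" using assms(3)[of z] by (auto intro: DERIV_unique)
  with z assms(1) assms(4)[of z] show ?thesis by (simp add: sgn_mult)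
qed

subsection \<open>The truncated power kernel\<close>

text \<open>Since \<open>0 powr \<alpha> = 0\<close> for every \<open>\<alpha>\<close>, the exponent \<open>0\<close> gives the indicator of the positive reals.\<close>
definition tpow :: "real \<Rightarrow> real \<Rightarrow> real" where
  "tpow \<alpha> t = max 0 t powr \<alpha>"

lemma tpow_nonpos [simp]: "t \<le> 0 \<Longrightarrow> tpow \<alpha> t = 0"
  and tpow_pos: "t > 0 \<Longrightarrow> tpow \<alpha> t = t powr \<alpha>"
  by (auto simp: tpow_def max_def)

lemma tpow_mult_pos: "c > 0 \<Longrightarrow> tpow \<alpha> (c * t) = c powr \<alpha> * tpow \<alpha> t"
  by (cases "t > 0") (simp_all add: tpow_pos powr_mult zero_less_mult_iff mult_le_0_iff)

lemma tpow_has_real_derivative: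
  assumes "x \<noteq> Y"
  shows "((\<lambda>x. tpow \<alpha> (x - Y)) has_real_derivative \<alpha> * tpow (\<alpha> - 1) (x - Y)) (at x)"
proof (cases "x > Y")
  case True
  have "((\<lambda>x. (x - Y) powr \<alpha>) has_real_derivative \<alpha> * tpow (\<alpha> - 1) (x - Y)) (at x)"
    using True by (auto intro!: derivative_eq_intros simp: tpow_pos)
  then show ?thesis
    by (rule has_field_derivative_transform_within_open[where S = "{Y<..}"])
      (use True in \<open>auto simp: tpow_pos\<close>)
next
  case False
  with assms have "x < Y" by simp
  have "((\<lambda>x. 0) has_real_derivative 0) (at x)" by simp
  then have "((\<lambda>x. tpow \<alpha> (x - Y)) has_real_derivative 0) (at x)"
    by (rule has_field_derivative_transform_within_open[where S = "{..<Y}"])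
      (use \<open>x < Y\<close> in auto)
  then show ?thesis using \<open>x < Y\<close> by simp
qed

lemma continuous_on_tpow: "\<alpha> > 0 \<Longrightarrow> continuous_on A (\<lambda>x. tpow \<alpha> (x - Y))"
  unfolding tpow_def by (intro continuous_on_powr' continuous_intros) auto

text \<open>Strictly to the right of the knot every exponent is admissible. The sign computation
  relies on this, since its recursion can make the exponent negative.\<close>

lemma continuous_on_tpow_pos:
  assumes "\<And>x. x \<in> A \<Longrightarrow> x > Y"
  shows "continuous_on A (\<lambda>x. tpow \<alpha> (x - Y))"
  unfolding tpow_def using assms by (intro continuous_intros) (force simp: max_def)+

lemma det_tpow_reduce:
  fixes x y :: "nat \<Rightarrow> real"
  assumes x: "strict_mono_on {..<Suc m} x" and y: "strict_mono_on {..<Suc m} y" and xy: "y 0 < x 0"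
  obtains t Y C where "strict_mono_on {..<Suc m} t" "strict_mono_on {..<m} Y"
    "\<And>i j. i < Suc m \<Longrightarrow> j < m \<Longrightarrow> y (Suc j) < x i \<Longrightarrow> Y j < t i" "C > 0"
    "Determinant.det (Matrix.mat (Suc m) (Suc m) (\<lambda>(i, j). tpow \<alpha> (x i - y j))) =
      C * Determinant.det (Matrix.mat m m (\<lambda>(i, j). tpow \<alpha> (t (Suc i) - Y j) - tpow \<alpha> (t i - Y j)))"
proof
  define d where "d = (\<lambda>j. y (Suc j) - y 0)"
  define t where "t = (\<lambda>i. - 1 / (x i - y 0))"
  define Y where "Y = (\<lambda>j. - 1 / d j)"
  define a where "a = (\<lambda>i. (x i - y 0) powr \<alpha>)"
  \<comment> \<open>Column 0 is already normalised by \<open>a\<close>, so its factor is 1; column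
    \<open>j > 0\<close> belongs to \<open>d (j - 1)\<close>.\<close>
  define b where "b = (\<lambda>j. if j = 0 then 1 else d (j - 1) powr \<alpha>)"
  have xpos: "x i - y 0 > 0" if "i < Suc m" for i
  proof -
    have "x 0 \<le> x i" using strict_mono_onD[OF x, of 0 i] that by (cases "i = 0") auto
    with xy show ?thesis by simp
  qed
  have dpos: "d j > 0" if "j < m" for j
    using strict_mono_onD[OF y, of 0 "Suc j"] that by (simp add: d_def)
  show "strict_mono_on {..<Suc m} t"
  proof (rule strict_mono_onI)
    fix i j assume "i \<in> {..<Suc m}" "j \<in> {..<Suc m}" "i < j"
    then show "t i < t j"
      using strict_mono_onD[OF x, of i j] xpos[of i] by (simp add: t_def frac_less2)
  qed
  show "strict_mono_on {..<m} Y"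
  proof (rule strict_mono_onI)
    fix i j assume "i \<in> {..<m}" "j \<in> {..<m}" "i < j"
    then show "Y i < Y j"
      using strict_mono_onD[OF y, of "Suc i" "Suc j"] dpos[of i]
      by (simp add: Y_def frac_less2 d_def)
  qed
  show "Y j < t i" if "i < Suc m" "j < m" "y (Suc j) < x i" for i j
    using that dpos[of j] by (simp add: Y_def t_def d_def frac_less2)
  \<comment> \<open>With \<open>u = x i - y 0\<close> this is
    \<open>u - d = u * d * (1 / d - 1 / u)\<close>, where \<open>d = d j\<close>. Both
    \<open>u\<close> and \<open>d\<close> are positive, so the factor can be taken out of
    \<open>tpow\<close>.\<close>
  have factor: "x i - y (Suc j) = ((x i - y 0) * d j) * (t i - Y j)"
    if "i < Suc m" "j < m" for i j
  proof -
    have "((x i - y 0) * d j) * (t i - Y j) = (x i - y 0) - d j"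
      using xpos[OF that(1)] dpos[OF that(2)] by (simp add: t_def Y_def divide_simps)
        (simp add: algebra_simps)?
    then show ?thesis by (simp add: d_def)
  qed
  have entry: "tpow \<alpha> (x i - y j) = a i * b j * (if j = 0 then 1 else tpow \<alpha> (t i - Y (j - 1)))"
    if "i < Suc m" "j < Suc m" for i j
  proof (cases j)
    case 0
    then show ?thesis using xpos[OF that(1)] by (simp add: a_def b_def tpow_pos)
  next
    case (Suc k)
    then have k: "k < m" using that by simp
    show ?thesis
      unfolding Suc factor[OF that(1) k] using xpos[OF that(1)] dpos[OF k]
      by (simp add: tpow_mult_pos a_def b_def powr_mult)
  qed
  define C where "C = (\<Prod>i<Suc m. a i) * (\<Prod>j<Suc m. b j)"
  have "a i > 0" if "i < Suc m" for i
    using xpos[OF that] by (simp add: a_def)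
  moreover have "b j > 0" if "j < Suc m" for j
    using dpos[of "j - 1"] that by (cases j) (simp_all add: b_def)
  ultimately show "C > 0"
    unfolding C_def by (intro mult_pos_pos prod_pos) auto
  have "Matrix.mat (Suc m) (Suc m) (\<lambda>(i, j). tpow \<alpha> (x i - y j)) =
    Matrix.mat (Suc m) (Suc m) (\<lambda>(i, j). a i * b j * (if j = 0 then 1 else tpow \<alpha> (t i - Y (j - 1))))"
    by (intro eq_matI) (auto simp: entry)
  then show "Determinant.det (Matrix.mat (Suc m) (Suc m) (\<lambda>(i, j). tpow \<alpha> (x i - y j))) =
      C * Determinant.det (Matrix.mat m m (\<lambda>(i, j). tpow \<alpha> (t (Suc i) - Y j) - tpow \<alpha> (t i - Y j)))"
    by (simp only: det_mat_scale C_def det_ones_first_column[of m "\<lambda>i j. tpow \<alpha> (t i - Y j)"])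
qed

lemma strict_mono_on_interlace:
  fixes t \<tau> :: "nat \<Rightarrow> real"
  assumes t: "strict_mono_on {..<Suc m} t" and \<tau>: "\<And>i. i < m \<Longrightarrow> t i < \<tau> i \<and> \<tau> i < t (Suc i)"
  shows "strict_mono_on {..<m} \<tau>"
proof (rule strict_mono_onI)
  fix i j assume ij: "i \<in> {..<m}" "j \<in> {..<m}" "i < j"
  then have "t (Suc i) \<le> t j"
    using strict_mono_onD[OF t, of "Suc i" j] by (cases "Suc i = j") auto
  then show "\<tau> i < \<tau> j" using \<tau>[of i] \<tau>[of j] ij by auto
qed

lemma det_tpow_deriv:
  "Determinant.det (Matrix.mat m m (\<lambda>(i, j). \<alpha> * tpow (\<alpha> - 1) (\<tau> i - Y j))) =
    \<alpha> ^ m * Determinant.det (Matrix.mat m m (\<lambda>(i, j). tpow (\<alpha> - 1) (\<tau> i - Y j)))"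
  using det_mat_scale[of m "\<lambda>_. \<alpha>" "\<lambda>_. 1" "\<lambda>i j. tpow (\<alpha> - 1) (\<tau> i - Y j)"] by simp

text \<open>Each reduction lowers order and exponent by one. The stage with exponent
  \<open>\<alpha> - k\<close> differentiates \<open>m - k\<close> rows, each contributing a factor
  \<open>\<alpha> - k\<close>.\<close>

lemma sgn_det_tpow:
  fixes x y :: "nat \<Rightarrow> real"
  assumes "strict_mono_on {..<Suc m} x" "strict_mono_on {..<Suc m} y"
    and "\<And>i j. i < Suc m \<Longrightarrow> j < Suc m \<Longrightarrow> y j < x i"
  shows "sgn (Determinant.det (Matrix.mat (Suc m) (Suc m) (\<lambda>(i, j). tpow \<alpha> (x i - y j)))) =
    (\<Prod>k<m. sgn (\<alpha> - real k) ^ (m - k))"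
  using assms
proof (induction m arbitrary: \<alpha> x y)
  case 0
  from 0(3)[of 0 0] have "tpow \<alpha> (x 0 - y 0) > 0" by (simp add: tpow_pos)
  moreover have "Determinant.det (Matrix.mat (Suc 0) (Suc 0) (\<lambda>(i, j). tpow \<alpha> (x i - y j))) =
    tpow \<alpha> (x 0 - y 0)"
    by (subst det_single) auto
  ultimately show ?case by simp
next
  case (Suc m)
  let ?n = "Suc m"
  have xy: "y 0 < x 0" using Suc.prems(3)[of 0 0] by simp
  obtain t Y C where t: "strict_mono_on {..<Suc ?n} t" and Y: "strict_mono_on {..<?n} Y"
    and Yt: "\<And>i j. i < Suc ?n \<Longrightarrow> j < ?n \<Longrightarrow> y (Suc j) < x i \<Longrightarrow> Y j < t i" and C: "C > 0"
    and eq: "Determinant.det (Matrix.mat (Suc ?n) (Suc ?n) (\<lambda>(i, j). tpow \<alpha> (x i - y j))) =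
      C * Determinant.det (Matrix.mat ?n ?n (\<lambda>(i, j). tpow \<alpha> (t (Suc i) - Y j) - tpow \<alpha> (t i - Y j)))"
    by (rule det_tpow_reduce[OF Suc.prems(1,2) xy, where \<alpha> = \<alpha>], rule that)
  \<comment> \<open>All knots lie to the left of all intervals, so the kernel is differentiable
    there and the exceptional set can be empty.\<close>
  have Yt: "Y j < t i" if "i < Suc ?n" "j < ?n" for i j
    using that Yt Suc.prems(3) by simp
  define s where "s = (\<Prod>k<?n. sgn (\<alpha> - real k) ^ (?n - k))"
  have "sgn (Determinant.det (Matrix.mat ?n ?n
      (\<lambda>(i, j). tpow \<alpha> (t (Suc i) - Y j) - tpow \<alpha> (t i - Y j)))) = s"
  proof (rule det_differences_cone[where S = "{}" and P = "\<lambda>v. sgn v = s"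
        and G = "\<lambda>j x. tpow \<alpha> (x - Y j)" and G' = "\<lambda>j x. \<alpha> * tpow (\<alpha> - 1) (x - Y j)"
        and a = t and b = "\<lambda>i. t (Suc i)"])
    show "sgn (h b - h a) = s"
      if "a < b" "continuous_on {a..b} h"
        "\<And>x. x \<in> {a<..<b} - {} \<Longrightarrow> (h has_real_derivative h' x) (at x)"
        "\<And>x. x \<in> {a<..<b} - {} \<Longrightarrow> sgn (h' x) = s" for h h' :: "real \<Rightarrow> real" and a b
      using that by (intro increment_sgn[of a b h h' s]) auto
    show "t i < t (Suc i)" if "i < ?n" for i
      using strict_mono_onD[OF t, of i "Suc i"] that by simp
    show "continuous_on {t i..t (Suc i)} (\<lambda>x. tpow \<alpha> (x - Y j))" if "i < ?n" "j < ?n" for i j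
      using Yt[of i j] that by (intro continuous_on_tpow_pos) auto
    show "((\<lambda>x. tpow \<alpha> (x - Y j)) has_real_derivative \<alpha> * tpow (\<alpha> - 1) (x - Y j)) (at x)"
      if "i < ?n" "j < ?n" "x \<in> {t i<..<t (Suc i)} - {}" for i j x
      using Yt[of i j] that by (intro tpow_has_real_derivative) auto
    fix \<tau> assume \<tau>: "\<And>i. i < ?n \<Longrightarrow> \<tau> i \<in> {t i<..<t (Suc i)} - {}"
    have "sgn (Determinant.det (Matrix.mat ?n ?n (\<lambda>(i, j). tpow (\<alpha> - 1) (\<tau> i - Y j)))) =
        (\<Prod>k<m. sgn (\<alpha> - 1 - real k) ^ (m - k))"
    proof (rule Suc.IH)
      show "strict_mono_on {..<?n} \<tau>"
        using \<tau> by (intro strict_mono_on_interlace[OF t]) auto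
      show "Y j < \<tau> i" if "i < ?n" "j < ?n" for i j
        using Yt[of i j] \<tau>[of i] that by auto
    qed (rule Y)
    \<comment> \<open>The factor for \<open>k = 0\<close> comes from the \<open>?n\<close>
      differentiated rows; shifting the index turns the rest into the product for
      \<open>\<alpha> - 1\<close>.\<close>
    moreover have "s = sgn \<alpha> ^ ?n * (\<Prod>k<m. sgn (\<alpha> - 1 - real k) ^ (m - k))"
      unfolding s_def by (subst prod.lessThan_Suc_shift) (simp add: algebra_simps)
    ultimately show "sgn (Determinant.det (Matrix.mat ?n ?n
        (\<lambda>(i, j). \<alpha> * tpow (\<alpha> - 1) (\<tau> i - Y j)))) = s"
      by (simp only: det_tpow_deriv sgn_mult power_sgn)
  qed
  with C show ?case by (simp only: eq sgn_mult s_def) simp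
qed

text \<open>If \<open>x 0 > y 1\<close>, the first two columns consist of ones and the determinant
  vanishes. Otherwise row 0 is zero beyond column 0, and expanding along it reduces the
  order.\<close>

lemma det_heaviside_nonneg:
  fixes x y :: "nat \<Rightarrow> real"
  assumes "strict_mono_on {..<n} x" "strict_mono_on {..<n} y"
  shows "Determinant.det (Matrix.mat n n (\<lambda>(i, j). tpow 0 (x i - y j))) \<ge> 0"
  using assms
proof (induction n arbitrary: x y)
  case 0
  then show ?case by simp
next
  case (Suc n)
  let ?A = "Matrix.mat (Suc n) (Suc n) (\<lambda>(i, j). tpow 0 (x i - y j))"
  have xm: "x 0 \<le> x i" if "i < Suc n" for i
    using strict_mono_onD[OF Suc.prems(1), of 0 i] that by (cases "i = 0") auto
  have ym: "y 1 \<le> y j" if "1 \<le> j" "j < Suc n" for j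
    using strict_mono_onD[OF Suc.prems(2), of 1 j] that by (cases "j = 1") auto
  have ym0: "y 0 < y j" if "j < Suc n" "j \<noteq> 0" for j
    using strict_mono_onD[OF Suc.prems(2), of 0 j] that by auto
  show ?case
  proof (cases "n > 0 \<and> x 0 > y 1")
    case True
    then have "y 0 < y 1" using ym0[of 1] by simp
    have "tpow 0 (x i - y j) = 1" if "i < Suc n" "j \<le> 1" for i j
    proof -
      have "j = 0 \<or> j = 1" using that by linarith
      then have "y j < x i" using True \<open>y 0 < y 1\<close> xm[of i] that by auto
      then show ?thesis by (simp add: tpow_pos)
    qed
    then have "Determinant.det ?A = 0"
      using True by (intro det_identical_columns[of ?A "Suc n" 0 1]) (auto intro!: eq_vecI)
    then show ?thesis by simp
  next
    case False
    have z: "?A $$ (0, j) = 0" if "j < Suc n" "j \<noteq> 0" for j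
      using False ym[of j] that by auto
    have "strict_mono_on {..<n} (\<lambda>i. x (Suc i))" "strict_mono_on {..<n} (\<lambda>i. y (Suc i))"
      using Suc.prems by (auto simp: strict_mono_on_def)
    note Suc.IH[OF this]
    also have "Matrix.mat n n (\<lambda>(i, j). tpow 0 (x (Suc i) - y (Suc j))) = mat_delete ?A 0 0"
      by (rule eq_matI) (auto simp: mat_delete_def)
    finally have "Determinant.det (mat_delete ?A 0 0) \<ge> 0" .
    then have cof: "cofactor ?A 0 0 \<ge> 0" by (simp add: cofactor_def)
    have "Determinant.det ?A = (\<Sum>j<Suc n. ?A $$ (0, j) * cofactor ?A 0 j)"
      by (rule laplace_expansion_row) auto
    also have "\<dots> = (\<Sum>j\<in>{0}. ?A $$ (0, j) * cofactor ?A 0 j)"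
    proof (rule sum.mono_neutral_right)
      show "\<forall>j\<in>{..<Suc n} - {0}. ?A $$ (0, j) * cofactor ?A 0 j = 0"
      proof
        fix j assume "j \<in> {..<Suc n} - {0}"
        then show "?A $$ (0, j) * cofactor ?A 0 j = 0" using z[of j]
          by (metis DiffD1 DiffD2 lessThan_iff mult_zero_left singletonI)
      qed
    qed auto
    also have "\<dots> = tpow 0 (x 0 - y 0) * cofactor ?A 0 0"
      by simp
    also have "\<dots> \<ge> 0"
      by (rule mult_nonneg_nonneg[OF _ cof]) (simp add: tpow_def)
    finally show ?thesis .
  qed
qed

text \<open>
  For \<open>\<alpha> \<le> 1\<close> the kernel is not differentiable at the knots \<open>Y\<close>, which is why the finite exceptional
  set is needed; for \<open>\<alpha> = 0\<close> it is not even continuous and the step kernel is treated separately.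
\<close>
lemma det_tpow_nonneg:
  fixes x y :: "nat \<Rightarrow> real"
  assumes "strict_mono_on {..<n} x" "strict_mono_on {..<n} y"
    and "\<alpha> > real n - 2 \<or> \<alpha> \<in> \<nat>"
  shows "Determinant.det (Matrix.mat n n (\<lambda>(i, j). tpow \<alpha> (x i - y j))) \<ge> 0"
  using assms
proof (induction n arbitrary: \<alpha> x y)
  case 0
  then show ?case by simp
next
  case (Suc m)
  let ?A = "Matrix.mat (Suc m) (Suc m) (\<lambda>(i, j). tpow \<alpha> (x i - y j))"
  \<comment> \<open>If \<open>x 0 \<le> y 0\<close>, the first row is zero. If
    \<open>y 0 < x 0\<close>, the first column is positive and the reduction applies; there
    \<open>m > 0\<close> and \<open>\<alpha> \<noteq> 0\<close> force
    \<open>\<alpha> > 0\<close>.\<close>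
  consider "\<alpha> = 0" | "m = 0" | "x 0 \<le> y 0" | "m > 0" "\<alpha> \<noteq> 0" "y 0 < x 0" by fastforce
  then show ?case
  proof cases
    case 1
    then show ?thesis using det_heaviside_nonneg Suc.prems by simp
  next
    case 2
    then show ?thesis by (subst det_single) (auto simp: tpow_def)
  next
    case 3
    have "x 0 \<le> y j" if "j < Suc m" for j
      using strict_mono_onD[OF Suc.prems(2), of 0 j] that 3 by (cases "j = 0") auto
    then have "Determinant.det ?A = 0"
      by (subst laplace_expansion_row[of _ "Suc m" 0]) auto
    then show ?thesis by simp
  next
    case 4
    obtain t Y C where t: "strict_mono_on {..<Suc m} t" and Y: "strict_mono_on {..<m} Y"
      and "\<And>i j. i < Suc m \<Longrightarrow> j < m \<Longrightarrow> y (Suc j) < x i \<Longrightarrow> Y j < t i" and C: "C > 0"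
      and eq: "Determinant.det ?A =
        C * Determinant.det (Matrix.mat m m (\<lambda>(i, j). tpow \<alpha> (t (Suc i) - Y j) - tpow \<alpha> (t i - Y j)))"
      by (rule det_tpow_reduce[OF Suc.prems(1,2) \<open>y 0 < x 0\<close>, where \<alpha> = \<alpha>], rule that)
    have \<alpha>: "\<alpha> > 0"
      using Suc.prems(3) 4 by (auto elim!: Nats_cases)
    \<comment> \<open>The alternative on the exponent survives the reduction: a positive natural
      number stays natural, and the lower bound drops by one together with the order.\<close>
    have \<alpha>': "\<alpha> - 1 > real m - 2 \<or> \<alpha> - 1 \<in> \<nat>"
    proof (cases "\<alpha> \<in> \<nat>")
      case True
      then obtain k where "\<alpha> = real k" by (auto elim: Nats_cases)
      then have "\<alpha> - 1 = real (k - 1)" using \<alpha> by (simp add: of_nat_diff)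
      then show ?thesis by simp
    qed (use Suc.prems(3) in auto)
    have "Determinant.det (Matrix.mat m m (\<lambda>(i, j). tpow \<alpha> (t (Suc i) - Y j) - tpow \<alpha> (t i - Y j))) \<ge> 0"
    proof (rule det_differences_cone[where S = "Y ` {..<m}" and P = "\<lambda>v. v \<ge> 0"
          and G = "\<lambda>j x. tpow \<alpha> (x - Y j)" and G' = "\<lambda>j x. \<alpha> * tpow (\<alpha> - 1) (x - Y j)"
          and a = t and b = "\<lambda>i. t (Suc i)"])
      show "h b - h a \<ge> 0"
        if "a < b" "continuous_on {a..b} h"
          "\<And>x. x \<in> {a<..<b} - Y ` {..<m} \<Longrightarrow> (h has_real_derivative h' x) (at x)"
          "\<And>x. x \<in> {a<..<b} - Y ` {..<m} \<Longrightarrow> h' x \<ge> 0" for h h' :: "real \<Rightarrow> real" and a b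
        using that by (intro increment_nonneg_off_finite[of "Y ` {..<m}" a b h h']) auto
      show "t i < t (Suc i)" if "i < m" for i
        using strict_mono_onD[OF t, of i "Suc i"] that by simp
      show "continuous_on {t i..t (Suc i)} (\<lambda>x. tpow \<alpha> (x - Y j))" for i j
        by (rule continuous_on_tpow[OF \<alpha>])
      show "((\<lambda>x. tpow \<alpha> (x - Y j)) has_real_derivative \<alpha> * tpow (\<alpha> - 1) (x - Y j)) (at x)"
        if "j < m" "x \<in> {t i<..<t (Suc i)} - Y ` {..<m}" for i j x
        using that by (intro tpow_has_real_derivative) auto
      fix \<tau> assume \<tau>: "\<And>i. i < m \<Longrightarrow> \<tau> i \<in> {t i<..<t (Suc i)} - Y ` {..<m}"
      have "strict_mono_on {..<m} \<tau>"
        using \<tau> by (intro strict_mono_on_interlace[OF t]) auto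
      from Suc.IH[OF this Y \<alpha>'] \<alpha>
      show "Determinant.det (Matrix.mat m m (\<lambda>(i, j). \<alpha> * tpow (\<alpha> - 1) (\<tau> i - Y j))) \<ge> 0"
        by (simp add: det_tpow_deriv)
    qed
    with C show ?thesis by (simp add: eq)
  qed
qed

subsection \<open>The density of the weighted sum\<close>

text \<open>The branch \<open>c = 0\<close> is the one that \<open>q = r\<close> leads to.\<close>

definition exp_primitive :: "real \<Rightarrow> real \<Rightarrow> real" where
  "exp_primitive c x = (if c = 0 then x else exp (c * x) / c)"

lemma exp_primitive_has_real_derivative:
  "(exp_primitive c has_real_derivative exp (c * x)) (at x)"
proof (cases "c = 0")
  case True
  then have "exp_primitive c = (\<lambda>x. x)" by (auto simp: exp_primitive_def)
  with True show ?thesis by simp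
next
  case False
  then have "exp_primitive c = (\<lambda>x. exp (c * x) / c)" by (auto simp: exp_primitive_def)
  with False show ?thesis by (auto intro!: derivative_eq_intros)
qed

lemma strict_mono_exp_primitive: "strict_mono (exp_primitive c)"
  by (rule strict_monoI, rule DERIV_pos_imp_increasing)
    (auto intro!: exI[of _ "exp (c * _)"] exp_primitive_has_real_derivative)

lemma continuous_on_exp_primitive [continuous_intros]:
  "continuous_on A f \<Longrightarrow> continuous_on A (\<lambda>x. exp_primitive c (f x))"
  by (rule continuous_on_compose2[of UNIV "exp_primitive c"])
    (auto intro!: DERIV_continuous_on exp_primitive_has_real_derivative)

text \<open>This is the integral of \<open>exp (- (x - s) / q) * exp (- s / r) / (q * r)\<close>
  over \<open>s\<close> from 0 to \<open>max 0 x\<close>. It equals the usual two-case formula, and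
  \<open>max\<close> makes it vanish for negative \<open>x\<close>.\<close>

definition hypoexp_density :: "real \<Rightarrow> real \<Rightarrow> real \<Rightarrow> real" where
  "hypoexp_density q r x = exp (- x / q) / (q * r) *
    (exp_primitive (1 / q - 1 / r) (max 0 x) - exp_primitive (1 / q - 1 / r) 0)"

text \<open>
  Because of the divisor \<open>c\<close> in \<^const>\<open>exp_primitive\<close>, the function \<open>E\<close> is increasing for either sign
  of \<open>c = 1 / r - 1 / q\<close>, so that \<open>q < r\<close>, \<open>q = r\<close> and \<open>q > r\<close> need no separate treatment.
\<close>
lemma hypoexp_density_factor:
  assumes "q > 0" "r > 0"
  shows "hypoexp_density q r (x - y) = exp (- x / r) / (q * r) * exp (y / q) *
    max 0 (exp_primitive (1 / r - 1 / q) x - exp_primitive (1 / r - 1 / q) y)"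
proof (cases "x > y")
  case True
  define c where "c = 1 / r - 1 / q"
  \<comment> \<open>Both sides are the integral of \<open>exp (- c * u)\<close> over
    \<open>u\<close> from 0 to \<open>x - y\<close>, the right one after substituting
    \<open>u = x - s\<close>.\<close>
  have "exp_primitive (- c) (x - y) - exp_primitive (- c) 0 =
      exp (- c * x) * (exp_primitive c x - exp_primitive c y)"
    by (simp add: exp_primitive_def field_simps mult_exp_exp)
  moreover have "1 / q - 1 / r = - c" by (simp add: c_def)
  moreover have "exp (- (x - y) / q) * exp (- c * x) = exp (- x / r) * exp (y / q)"
    by (simp add: mult_exp_exp c_def algebra_simps diff_divide_distrib)
  ultimately have "hypoexp_density q r (x - y) =
      exp (- x / r) / (q * r) * exp (y / q) * (exp_primitive c x - exp_primitive c y)"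
    using True by (simp add: hypoexp_density_def)
  then show ?thesis
    using True strict_mono_less[OF strict_mono_exp_primitive, of c y x]
    by (simp only: c_def [symmetric]) simp
next
  case False
  then have "exp_primitive (1 / r - 1 / q) x \<le> exp_primitive (1 / r - 1 / q) y"
    by (simp add: strict_mono_less_eq[OF strict_mono_exp_primitive])
  with False show ?thesis by (simp add: hypoexp_density_def)
qed

lemma hypoexp_density_nonneg: "q > 0 \<Longrightarrow> r > 0 \<Longrightarrow> hypoexp_density q r x \<ge> 0"
  using hypoexp_density_factor[of q r x 0] by simp

section \<open>Identification of \<Omega> with the explicit density\<close>

text \<open>The integrand is supported on \<open>{0..x}\<close>, where the two exponentials combine
  to \<open>K * exp (c * y)\<close>; \<open>exp_primitive\<close> integrates this. For
  \<open>x < 0\<close> the interval is empty.\<close>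

lemma nn_integral_exponential_convolution:
  assumes "q > 0" "r > 0"
  shows "(\<integral>\<^sup>+ y. ennreal (exponential_density 1 ((x - y) / q)) / ennreal q *
      (ennreal (exponential_density 1 (y / r)) / ennreal r) \<partial>lborel) = ennreal (hypoexp_density q r x)"
proof -
  define c where "c = 1 / q - 1 / r"
  define K where "K = exp (- x / q) / (q * r)"
  have K: "K > 0" using assms by (simp add: K_def)
  have "ennreal (exponential_density 1 ((x - y) / q)) / ennreal q *
      (ennreal (exponential_density 1 (y / r)) / ennreal r) =
      ennreal K * (ennreal (exp (c * y)) * indicator {0..x} y)" for y
  proof -
    have "ennreal (exponential_density 1 ((x - y) / q)) / ennreal q *
      (ennreal (exponential_density 1 (y / r)) / ennreal r) =
      ennreal (exponential_density 1 ((x - y) / q) / q * (exponential_density 1 (y / r) / r))"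
      using assms by (simp add: divide_ennreal ennreal_mult [symmetric])
    also have "exponential_density 1 ((x - y) / q) / q * (exponential_density 1 (y / r) / r) =
      K * (exp (c * y) * indicator {0..x} y)"
    proof (cases "y \<in> {0..x}")
      case True
      have "exp (- ((x - y) / q)) * exp (- (y / r)) = exp (- x / q) * exp (c * y)"
        by (simp add: mult_exp_exp c_def algebra_simps diff_divide_distrib)
      with True assms show ?thesis
        by (simp add: exponential_density_def K_def divide_less_0_iff field_simps)
    next
      case False
      with assms show ?thesis
        by (auto simp: exponential_density_def divide_less_0_iff not_le)
    qed
    finally show ?thesis using K by (simp add: ennreal_mult ennreal_indicator)
  qed
  then have "(\<integral>\<^sup>+ y. ennreal (exponential_density 1 ((x - y) / q)) / ennreal q *
      (ennreal (exponential_density 1 (y / r)) / ennreal r) \<partial>lborel) =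
      ennreal K * (\<integral>\<^sup>+ y. ennreal (exp (c * y)) * indicator {0..x} y \<partial>lborel)"
    by (simp add: nn_integral_cmult)
  also have "\<dots> = ennreal (hypoexp_density q r x)"
  proof (cases "x \<ge> 0")
    case True
    then have "(\<integral>\<^sup>+ y. ennreal (exp (c * y)) * indicator {0..x} y \<partial>lborel) =
      ennreal (exp_primitive c x - exp_primitive c 0)"
      by (intro nn_integral_FTC_Icc exp_primitive_has_real_derivative) auto
    with True K show ?thesis
      by (simp add: hypoexp_density_def K_def c_def ennreal_mult' [symmetric])
  qed (simp add: hypoexp_density_def)
  finally show ?thesis .
qed

text \<open>The set where the functions differ is open, and a nonempty open set is not a null
  set.\<close>

lemma continuous_AE_lborel_eq:
  fixes f g :: "'a::euclidean_space \<Rightarrow> real"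
  assumes "continuous_on UNIV f" "continuous_on UNIV g" "AE x in lborel. f x = g x"
  shows "f x = g x"
proof (rule ccontr)
  assume "f x \<noteq> g x"
  have "open {x. f x \<noteq> g x}"
    using assms(1,2) by (rule open_Collect_neq)
  then have "\<not> negligible {x. f x \<noteq> g x}"
    using \<open>f x \<noteq> g x\<close> by (intro open_not_negligible) auto
  moreover have "{x. f x \<noteq> g x} \<in> null_sets lborel"
    using assms(3) \<open>open {x. f x \<noteq> g x}\<close> AE_iff_null_sets[of "{x. f x \<noteq> g x}" lborel] by simp
  then have "negligible {x. f x \<noteq> g x}"
    by (simp add: negligible_iff_null_sets null_sets_completionI)
  ultimately show False by blast
qed

text \<open>A density is determined only almost everywhere; continuity of both candidates upgrades
  this to equality at every point.\<close>

lemma (in prob_space) continuous_density_exponential_sum: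
  assumes "q > 0" "r > 0"
    and X1: "distributed M lborel X1 (\<lambda>x. ennreal (exponential_density 1 x))"
    and X2: "distributed M lborel X2 (\<lambda>x. ennreal (exponential_density 1 x))"
    and indep: "indep_var borel X1 borel X2"
    and nonneg: "\<And>x. \<Omega> x \<ge> 0" and cont: "continuous_on UNIV \<Omega>"
    and \<Omega>: "distributed M lborel (\<lambda>\<omega>. q * X1 \<omega> + r * X2 \<omega>) (\<lambda>x. ennreal (\<Omega> x))"
  shows "\<Omega> = hypoexp_density q r"
proof
  fix x
  have "distributed M lborel (\<lambda>\<omega>. q * X1 \<omega>) (\<lambda>x. ennreal (exponential_density 1 (x / q)) / ennreal q)"
    using distributed_affine[OF X1, of q 0] assms(1) by simp
  moreover have "distributed M lborel (\<lambda>\<omega>. r * X2 \<omega>) (\<lambda>x. ennreal (exponential_density 1 (x / r)) / ennreal r)"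
    using distributed_affine[OF X2, of r 0] assms(2) by simp
  moreover have "indep_var borel (\<lambda>\<omega>. q * X1 \<omega>) borel (\<lambda>\<omega>. r * X2 \<omega>)"
    using indep_var_compose[OF indep, of "\<lambda>x. q * x" borel "\<lambda>x. r * x" borel] by (simp add: o_def)
  ultimately have "distributed M lborel (\<lambda>\<omega>. q * X1 \<omega> + r * X2 \<omega>) (\<lambda>x. ennreal (hypoexp_density q r x))"
    using distributed_convolution nn_integral_exponential_convolution[OF assms(1,2)] by fastforce
  with \<Omega> have "AE x in lborel. ennreal (\<Omega> x) = ennreal (hypoexp_density q r x)"
    unfolding distributed_def by (intro sigma_finite_measure.density_unique [OF sigma_finite_lborel]) auto
  then have "AE x in lborel. \<Omega> x = hypoexp_density q r x"
    by (rule AE_mp) (auto simp: nonneg hypoexp_density_nonneg assms)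
  moreover have "continuous_on UNIV (hypoexp_density q r)"
    unfolding hypoexp_density_def using assms by (intro continuous_intros) auto
  ultimately show "\<Omega> x = hypoexp_density q r x"
    by (intro continuous_AE_lborel_eq cont)
qed

subsection \<open>Determinants of powers of the density\<close>

text \<open>For \<open>\<alpha> = 0\<close> the conventions disagree when \<open>x \<le> y\<close>:
  \<open>rpow\<close> gives 1 and \<open>tpow\<close> gives 0. Hence the side condition.\<close>

lemma rpow_hypoexp_density:
  assumes "q > 0" "r > 0" and "\<alpha> \<noteq> 0 \<or> y < x"
  shows "rpow (hypoexp_density q r (x - y)) \<alpha> =
    (exp (- x / r) / (q * r)) powr \<alpha> * exp (y / q) powr \<alpha> *
    tpow \<alpha> (exp_primitive (1 / r - 1 / q) x - exp_primitive (1 / r - 1 / q) y)"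
proof (cases "\<alpha> = 0")
  case True
  with assms strict_mono_less[OF strict_mono_exp_primitive, of "1 / r - 1 / q" y x]
  show ?thesis by (simp add: rpow_def tpow_pos)
next
  case False
  then show ?thesis
    by (simp only: rpow_def hypoexp_density_factor [OF assms(1,2)] tpow_def powr_mult if_False)
qed

lemma det_rpow_hypoexp_density:
  assumes "q > 0" "r > 0" and "\<alpha> \<noteq> 0 \<or> (\<forall>i<n. \<forall>j<n. y j < x i)"
  obtains C where "C > 0"
    "Determinant.det (Matrix.mat n n (\<lambda>(i, j). rpow (hypoexp_density q r (x i - y j)) \<alpha>)) =
      C * Determinant.det (Matrix.mat n n (\<lambda>(i, j).
        tpow \<alpha> (exp_primitive (1 / r - 1 / q) (x i) - exp_primitive (1 / r - 1 / q) (y j))))"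
proof
  let ?E = "exp_primitive (1 / r - 1 / q)"
  let ?a = "\<lambda>i. (exp (- x i / r) / (q * r)) powr \<alpha>" and ?b = "\<lambda>j. exp (y j / q) powr \<alpha>"
  show "(\<Prod>i<n. ?a i) * (\<Prod>j<n. ?b j) > 0"
    using assms by (intro mult_pos_pos prod_pos) auto
  have "Matrix.mat n n (\<lambda>(i, j). rpow (hypoexp_density q r (x i - y j)) \<alpha>) =
      Matrix.mat n n (\<lambda>(i, j). ?a i * ?b j * tpow \<alpha> (?E (x i) - ?E (y j)))"
    using assms by (intro eq_matI) (auto simp: rpow_hypoexp_density)
  then show "Determinant.det (Matrix.mat n n (\<lambda>(i, j). rpow (hypoexp_density q r (x i - y j)) \<alpha>)) =
      (\<Prod>i<n. ?a i) * (\<Prod>j<n. ?b j) *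
        Determinant.det (Matrix.mat n n (\<lambda>(i, j). tpow \<alpha> (?E (x i) - ?E (y j))))"
    by (simp only: det_mat_scale)
qed

lemma strict_mono_on_exp_primitive:
  "strict_mono_on A x \<Longrightarrow> strict_mono_on A (\<lambda>i. exp_primitive c (x i))"
  using strict_mono_less[OF strict_mono_exp_primitive] by (simp add: strict_mono_on_def)

lemma TN_kernel_hypoexp_density:
  assumes qr: "q > 0" "r > 0" and \<alpha>: "\<alpha> \<in> \<nat> \<or> \<alpha> > real p - 2"
  shows "TN_kernel p (\<lambda>x. rpow (hypoexp_density q r x) \<alpha>)"
  unfolding TN_kernel_def
proof (intro allI impI, elim conjE)
  fix n and x y :: "nat \<Rightarrow> real"
  assume n: "1 \<le> n" "n \<le> p" and xy: "strict_mono_on {..<n} x" "strict_mono_on {..<n} y"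
  let ?A = "Matrix.mat n n (\<lambda>(i, j). rpow (hypoexp_density q r (x i - y j)) \<alpha>)"
  show "Determinant.det ?A \<ge> 0"
  \<comment> \<open>For \<open>\<alpha> = 0\<close> the matrix consists of ones, so two rows
    coincide unless \<open>n = 1\<close>.\<close>
  proof (cases "\<alpha> = 0")
    case True
    show ?thesis
    proof (cases "n = 1")
      case False
      then have "Determinant.det ?A = 0"
        using n True by (intro det_identical_rows[of ?A n 0 1]) (auto simp: rpow_def intro!: eq_vecI)
      then show ?thesis by simp
    qed (subst det_single, auto simp: True rpow_def)
  next
    case False
    then obtain C where "C > 0" and "Determinant.det ?A = C * Determinant.det (Matrix.mat n n (\<lambda>(i, j).
        tpow \<alpha> (exp_primitive (1 / r - 1 / q) (x i) - exp_primitive (1 / r - 1 / q) (y j))))"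
      by (rule det_rpow_hypoexp_density[OF qr disjI1])
    moreover have "\<alpha> > real n - 2 \<or> \<alpha> \<in> \<nat>" using \<alpha> n by auto
    ultimately show ?thesis
      using det_tpow_nonneg[OF strict_mono_on_exp_primitive[OF xy(1)] strict_mono_on_exp_primitive[OF xy(2)]]
      by simp
  qed
qed

lemma sgn_det_hypoexp_density:
  assumes qr: "q > 0" "r > 0"
    and xy: "strict_mono_on {..<Suc m} x" "strict_mono_on {..<Suc m} y"
    and less: "\<And>i j. i < Suc m \<Longrightarrow> j < Suc m \<Longrightarrow> y j < x i"
  shows "sgn (Determinant.det (Matrix.mat (Suc m) (Suc m)
      (\<lambda>(i, j). rpow (hypoexp_density q r (x i - y j)) \<alpha>))) = (\<Prod>k<m. sgn (\<alpha> - real k) ^ (m - k))"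
proof -
  let ?E = "exp_primitive (1 / r - 1 / q)"
  obtain C where "C > 0" and eq: "Determinant.det (Matrix.mat (Suc m) (Suc m)
      (\<lambda>(i, j). rpow (hypoexp_density q r (x i - y j)) \<alpha>)) =
      C * Determinant.det (Matrix.mat (Suc m) (Suc m) (\<lambda>(i, j). tpow \<alpha> (?E (x i) - ?E (y j))))"
    by (rule det_rpow_hypoexp_density[OF qr, where n = "Suc m" and x = x and y = y and \<alpha> = \<alpha>])
      (use less in auto)
  moreover have "sgn (Determinant.det (Matrix.mat (Suc m) (Suc m) (\<lambda>(i, j). tpow \<alpha> (?E (x i) - ?E (y j))))) =
      (\<Prod>k<m. sgn (\<alpha> - real k) ^ (m - k))"
    using less strict_mono_less[OF strict_mono_exp_primitive]
    by (intro sgn_det_tpow strict_mono_on_exp_primitive xy) auto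
  ultimately show ?thesis by (simp only: eq sgn_mult) simp
qed

text \<open>For \<open>n = Suc m\<close> the sign involves only \<open>\<alpha> - k\<close> with
  \<open>k \<le> n - 2\<close>, and all of these are positive.\<close>

lemma det_hypoexp_density_pos:
  assumes "q > 0" "r > 0" "strict_mono_on {..<n} x" "strict_mono_on {..<n} y"
    and "\<And>i j. i < n \<Longrightarrow> j < n \<Longrightarrow> y j < x i" and "\<alpha> > real n - 2"
  shows "Determinant.det (Matrix.mat n n (\<lambda>(i, j). rpow (hypoexp_density q r (x i - y j)) \<alpha>)) > 0"
proof (cases n)
  case (Suc m)
  have "(\<Prod>k<m. sgn (\<alpha> - real k) ^ (m - k)) = 1"
    using assms(6) Suc by (intro prod.neutral) (auto simp: sgn_if)
  then show ?thesis
    using sgn_det_hypoexp_density[of q r m x y \<alpha>] assms Suc by (simp add: sgn_1_pos)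
qed simp

text \<open>Only the last factor, \<open>\<alpha> - (n - 2)\<close>, is negative, and it has
  exponent 1.\<close>

lemma det_hypoexp_density_neg:
  assumes "q > 0" "r > 0" "strict_mono_on {..<n} x" "strict_mono_on {..<n} y"
    and "\<And>i j. i < n \<Longrightarrow> j < n \<Longrightarrow> y j < x i" and "n \<ge> 2" "real n - 3 < \<alpha>" "\<alpha> < real n - 2"
  shows "Determinant.det (Matrix.mat n n (\<lambda>(i, j). rpow (hypoexp_density q r (x i - y j)) \<alpha>)) < 0"
proof -
  obtain m where n: "n = Suc (Suc m)" using \<open>n \<ge> 2\<close> by (intro that[of "n - 2"]) simp
  have "(\<Prod>k<m. sgn (\<alpha> - real k) ^ (Suc m - k)) = 1"
    using assms(7) n by (intro prod.neutral) (auto simp: sgn_if)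
  then have "(\<Prod>k<Suc m. sgn (\<alpha> - real k) ^ (Suc m - k)) = -1"
    using assms(8) n by simp
  then show ?thesis
    using sgn_det_hypoexp_density[of q r "Suc m" x y \<alpha>] assms n by (simp add: sgn_1_neg)
qed

section \<open>Minors and the final assembly\<close>

text \<open>Enumerating \<open>I\<close> and \<open>J\<close> increasingly by \<open>pick\<close>
  turns a minor into a determinant of the same kernel at subsequences of the nodes.\<close>

lemma minor_mat:
  assumes "minor_index (Matrix.mat p p (\<lambda>(i, j). f i j)) I J"
  obtains n s t where "n = card I" "1 \<le> n" "n \<le> p"
    "strict_mono_on {..<n} s" "strict_mono_on {..<n} t"
    "\<And>i. i < n \<Longrightarrow> s i < p" "\<And>i. i < n \<Longrightarrow> t i < p"
    "submatrix (Matrix.mat p p (\<lambda>(i, j). f i j)) I J = Matrix.mat n n (\<lambda>(i, j). f (s i) (t j))"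
proof
  have I: "I \<subseteq> {..<p}" "I \<noteq> {}" and J: "J \<subseteq> {..<p}" "J \<noteq> {}" and card: "card J = card I"
    using assms by (auto simp: minor_index_def)
  have fin: "finite I" using I(1) finite_subset by blast
  show "1 \<le> card I" using fin I(2) by (simp add: Suc_le_eq card_gt_0_iff)
  show "card I \<le> p" using card_mono[OF _ I(1)] by simp
  show "strict_mono_on {..<card I} (pick I)" "strict_mono_on {..<card I} (pick J)"
    using card by (auto intro!: strict_mono_onI pick_mono_le)
  show s: "pick I i < p" if "i < card I" for i
    using pick_in_set_le[OF that] I by auto
  show t: "pick J i < p" if "i < card I" for i
    using pick_in_set_le[of i J] that card J by auto
  have "{i. i < p \<and> i \<in> I} = I" "{i. i < p \<and> i \<in> J} = J" using I J by auto
  then show "submatrix (Matrix.mat p p (\<lambda>(i, j). f i j)) I J =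
      Matrix.mat (card I) (card I) (\<lambda>(i, j). f (pick I i) (pick J j))"
    using s t by (intro eq_matI) (auto simp: submatrix_def card)
qed auto

theorem theorem3p3:
  fixes M :: "'a measure" and X1 X2 :: "'a \<Rightarrow> real" and \<Omega> :: "real \<Rightarrow> real"
    and q r \<alpha> :: real and p :: nat
  assumes "q > 0" and "r > 0"
    and "prob_space M"
    and "distributed M lborel X1 (\<lambda>x. ennreal (exponential_density 1 x))"
    and "distributed M lborel X2 (\<lambda>x. ennreal (exponential_density 1 x))"
    and "prob_space.indep_var M borel X1 borel X2"
    and "\<And>x. \<Omega> x \<ge> 0"
    and "continuous_on UNIV \<Omega>"
    and "distributed M lborel (\<lambda>\<omega>. q * X1 \<omega> + r * X2 \<omega>) (\<lambda>x. ennreal (\<Omega> x))"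
    and "p \<ge> 2" and "\<alpha> \<ge> 0"
  shows "(\<alpha> \<in> \<nat> \<or> \<alpha> > real p - 2 \<longrightarrow> TN_kernel p (\<lambda>x. rpow (\<Omega> x) \<alpha>))
       \<and> (0 < \<alpha> \<and> \<alpha> < real p - 2 \<and> \<alpha> \<notin> \<int> \<longrightarrow> \<not> TN_kernel p (\<lambda>x. rpow (\<Omega> x) \<alpha>))
       \<and> (\<forall>x y :: nat \<Rightarrow> real. strict_mono_on {..<p} x \<and> strict_mono_on {..<p} y \<longrightarrow>
            (\<exists>a :: real. let A = Matrix.mat p p (\<lambda>(j, k). rpow (\<Omega> (x j - y k - a)) \<alpha>) in
               (\<alpha> > real p - 2 \<longrightarrow> TP_mat A)
             \<and> (\<alpha> \<in> real ` {0..p - 2} \<longrightarrow> TN_mat A)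
             \<and> (0 < \<alpha> \<and> \<alpha> < real p - 2 \<and> \<alpha> \<notin> \<int> \<longrightarrow> has_neg_principal_minor A)))"
proof -
  have \<Omega>: "\<Omega> = hypoexp_density q r"
    using assms by (intro prob_space.continuous_density_exponential_sum[of M q r X1 X2 \<Omega>]) auto
  note qr = \<open>q > 0\<close> \<open>r > 0\<close>
  have TN: "TN_kernel p (\<lambda>x. rpow (\<Omega> x) \<alpha>)" if "\<alpha> \<in> \<nat> \<or> \<alpha> > real p - 2"
    unfolding \<Omega> by (rule TN_kernel_hypoexp_density[OF qr that])
  \<comment> \<open>This is the least order whose determinant is negative for separated nodes: it
    places \<open>\<alpha>\<close> strictly between \<open>n - 3\<close> and
    \<open>n - 2\<close>.\<close>
  define n where "n = nat \<lfloor>\<alpha>\<rfloor> + 3"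
  have n: "2 \<le> n" "n \<le> p" "real n - 3 < \<alpha>" "\<alpha> < real n - 2"
    if "0 < \<alpha>" "\<alpha> < real p - 2" "\<alpha> \<notin> \<int>"
  proof -
    have fl: "real (nat \<lfloor>\<alpha>\<rfloor>) = of_int \<lfloor>\<alpha>\<rfloor>" using that by simp
    have "of_int \<lfloor>\<alpha>\<rfloor> \<noteq> \<alpha>" using that by (metis Ints_of_int)
    then have "of_int \<lfloor>\<alpha>\<rfloor> < \<alpha>" using of_int_floor_le[of \<alpha>] by linarith
    then show "real n - 3 < \<alpha>" using fl by (simp add: n_def)
    show "\<alpha> < real n - 2" using fl by (simp add: n_def) linarith
    show "n \<le> p" using \<open>of_int \<lfloor>\<alpha>\<rfloor> < \<alpha>\<close> that fl unfolding n_def by linarith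
  qed (simp add: n_def)
  have minors: "\<exists>a. let A = Matrix.mat p p (\<lambda>(j, k). rpow (\<Omega> (x j - y k - a)) \<alpha>) in
               (\<alpha> > real p - 2 \<longrightarrow> TP_mat A)
             \<and> (\<alpha> \<in> real ` {0..p - 2} \<longrightarrow> TN_mat A)
             \<and> (0 < \<alpha> \<and> \<alpha> < real p - 2 \<and> \<alpha> \<notin> \<int> \<longrightarrow> has_neg_principal_minor A)"
    if x: "strict_mono_on {..<p} x" and y: "strict_mono_on {..<p} y" for x y :: "nat \<Rightarrow> real"
  proof -
    \<comment> \<open>The shift puts the largest \<open>z\<close>, namely \<open>z (p - 1)\<close>,
      at \<open>x 0 - 1\<close>, so every \<open>z k\<close> lies below every \<open>x j\<close> and
      all sign formulas apply.\<close>
    define a where "a = x 0 - y (p - 1) - 1"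
    define z where "z = (\<lambda>k. y k + a)"
    have zmono: "strict_mono_on {..<p} z" using y by (simp add: z_def strict_mono_on_def)
    have zx: "z k < x j" if "j < p" "k < p" for j k
    proof -
      have "x 0 \<le> x j" using strict_mono_onD[OF x, of 0 j] that by (cases "j = 0") auto
      moreover have "y k \<le> y (p - 1)"
      proof (cases "k = p - 1")
        case False
        with that have "k < p - 1" by linarith
        with strict_mono_onD[OF y, of k "p - 1"] that show ?thesis by simp
      qed simp
      ultimately show ?thesis by (simp add: z_def a_def)
    qed
    let ?A = "Matrix.mat p p (\<lambda>(j, k). rpow (\<Omega> (x j - z k)) \<alpha>)"
    have comp: "strict_mono_on {..<m} (\<lambda>i. u (s i))"
      if "strict_mono_on {..<p} u" "strict_mono_on {..<m} s" "\<And>i. i < m \<Longrightarrow> s i < p"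
      for u :: "nat \<Rightarrow> real" and s :: "nat \<Rightarrow> nat" and m
      using that by (simp add: strict_mono_on_def)
    have "TP_mat ?A" if \<alpha>: "\<alpha> > real p - 2"
      unfolding TP_mat_def
    proof (intro allI impI)
      fix I J assume idx: "minor_index ?A I J"
      obtain m s t where m: "m = card I" "1 \<le> m" "m \<le> p" and st: "strict_mono_on {..<m} s" "strict_mono_on {..<m} t"
        "\<And>i. i < m \<Longrightarrow> s i < p" "\<And>i. i < m \<Longrightarrow> t i < p"
        and sub: "submatrix ?A I J = Matrix.mat m m (\<lambda>(i, j). rpow (\<Omega> (x (s i) - z (t j))) \<alpha>)"
        by (rule minor_mat[OF idx], rule that)
      show "Determinant.det (submatrix ?A I J) > 0"
        unfolding sub unfolding \<Omega> using \<alpha> m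
        by (intro det_hypoexp_density_pos[OF qr] comp[OF x] comp[OF zmono] zx st) auto
    qed
    moreover have "TN_mat ?A" if "\<alpha> \<in> real ` {0..p - 2}"
      unfolding TN_mat_def
    proof (intro allI impI)
      fix I J assume idx: "minor_index ?A I J"
      obtain m s t where m: "m = card I" "1 \<le> m" "m \<le> p"
        and st: "strict_mono_on {..<m} s" "strict_mono_on {..<m} t"
        "\<And>i. i < m \<Longrightarrow> s i < p" "\<And>i. i < m \<Longrightarrow> t i < p"
        and sub: "submatrix ?A I J = Matrix.mat m m (\<lambda>(i, j). rpow (\<Omega> (x (s i) - z (t j))) \<alpha>)"
        by (rule minor_mat[OF idx], rule that)
      \<comment> \<open>For integer exponents the minors are covered by the total non-negativity of
        the kernel, applied to subsequences of the nodes.\<close>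
      have "\<alpha> \<in> \<nat>" using that by auto
      then show "Determinant.det (submatrix ?A I J) \<ge> 0"
        using TN m comp[OF x st(1,3)] comp[OF zmono st(2,4)] unfolding sub TN_kernel_def by simp
    qed
    moreover have "has_neg_principal_minor ?A" if \<alpha>: "0 < \<alpha>" "\<alpha> < real p - 2" "\<alpha> \<notin> \<int>"
    proof -
      \<comment> \<open>The negative minor is the leading principal one of order
        \<open>n\<close>.\<close>
      have idx: "minor_index ?A {..<n} {..<n}"
        using n[OF \<alpha>] by (auto simp: minor_index_def lessThan_empty_iff)
      obtain m s t where m: "m = card {..<n}" "1 \<le> m" "m \<le> p"
        and st: "strict_mono_on {..<m} s" "strict_mono_on {..<m} t"
        "\<And>i. i < m \<Longrightarrow> s i < p" "\<And>i. i < m \<Longrightarrow> t i < p"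
        and sub: "submatrix ?A {..<n} {..<n} = Matrix.mat m m (\<lambda>(i, j). rpow (\<Omega> (x (s i) - z (t j))) \<alpha>)"
        by (rule minor_mat[OF idx], rule that)
      have "Determinant.det (submatrix ?A {..<n} {..<n}) < 0"
        unfolding sub unfolding \<Omega> using n[OF \<alpha>] m
        by (intro det_hypoexp_density_neg[OF qr] comp[OF x] comp[OF zmono] zx st) auto
      with idx show ?thesis unfolding has_neg_principal_minor_def by blast
    qed
    moreover have "(\<lambda>(j, k). rpow (\<Omega> (x j - y k - a)) \<alpha>) = (\<lambda>(j, k). rpow (\<Omega> (x j - z k)) \<alpha>)"
      by (simp add: z_def diff_diff_eq)
    ultimately show ?thesis unfolding Let_def by (intro exI[of _ a]) simp
  qed
  have "\<not> TN_kernel p (\<lambda>x. rpow (\<Omega> x) \<alpha>)" if \<alpha>: "0 < \<alpha>" "\<alpha> < real p - 2" "\<alpha> \<notin> \<int>"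
  proof
    assume TN: "TN_kernel p (\<lambda>x. rpow (\<Omega> x) \<alpha>)"
    \<comment> \<open>These nodes are negative for \<open>j < n\<close>, hence below all the nodes
      \<open>real i\<close>.\<close>
    let ?y = "\<lambda>j. real j - real n"
    have mono: "strict_mono_on {..<n} real" "strict_mono_on {..<n} ?y"
      by (auto simp: strict_mono_on_def)
    have "Determinant.det (Matrix.mat n n (\<lambda>(i, j). rpow (\<Omega> (real i - ?y j)) \<alpha>)) < 0"
      unfolding \<Omega> using n[OF \<alpha>] by (intro det_hypoexp_density_neg[OF qr mono]) auto
    moreover have "Determinant.det (Matrix.mat n n (\<lambda>(i, j). rpow (\<Omega> (real i - ?y j)) \<alpha>)) \<ge> 0"
      using TN n[OF \<alpha>] mono unfolding TN_kernel_def by simp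
    ultimately show False by simp
  qed
  with TN minors show ?thesis by blast
qed

end
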